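(* Let $g_1, g_2 \geq 1$ be integers and assume that the set of prime divisors of $g_1$ is different from the set of prime divisors of $g_2$. Then $(\mathbb Z, d_{g_1})$ and $(\mathbb Z, d_{g_2})$ are not coarsely isomorphic.
   Context: $\mathbb N$ includes $0$. For an integer $g \geq 1$ let $S_g = \{\pm g^n : n \in \mathbb N\}$. The word length $\ell_g(n)$ of $n \in \mathbb Z$ is the minimal number of elements of $S_g$ (counted with multiplicity) adding up to $n$ (so $\ell_g(0)=0$), and $d_g(n,m) = \ell_g(n-m)$ is the induced translation-invariant metric on $\mathbb Z$. For metric spaces $(X,d_X)$, $(Y,d_Y)$: a function $f\colon X \to Y$ is controlled if for every $R \geq 0$ there is $S \geq 0$ such that $d_X(x,x') \leq R$ implies $d_Y(f(x),f(x')) \leq S$. Two functions $f,f'\colon X\to Y$ are close if $\sup_{x \in X} d_Y(f(x),f'(x)) < \infty$. A controlled function $f\colon X\to Y$ is a coarse equivalence if there is a controlled function $h\colon Y \to X$ (a coarse inverse) such that $h\circ f$ is close to $\mathrm{id}_X$ and $f \circ h$ is close to $\mathrm{id}_Y$. $(\mathbb Z, d_{g_1})$ and $(\mathbb Z, d_{g_2})$ (regarded as coarse groups under addition) are coarsely isomorphic if there exists a coarse equivalence $f\colon (\mathbb Z,d_{g_1}) \to (\mathbb Z,d_{g_2})$ that is a coarse homomorphism, i.e. for which there is a constant $C \geq 0$ with $d_{g_2}\bigl(f(a+b), f(a)+f(b)\bigr) \leq C$ for all $a,b \in \mathbb Z$. *)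

theory Defs
  imports "HOL-Analysis.Analysis" "HOL-Computational_Algebra.Computational_Algebra"
begin

definition controlled :: "'a metric \<Rightarrow> 'b metric \<Rightarrow> ('a \<Rightarrow> 'b) \<Rightarrow> bool" where
  "controlled X Y f \<longleftrightarrow>
     f \<in> mspace X \<rightarrow> mspace Y \<and>
     (\<forall>R\<ge>0. \<exists>S\<ge>0. \<forall>x\<in>mspace X. \<forall>x'\<in>mspace X.
        mdist X x x' \<le> R \<longrightarrow> mdist Y (f x) (f x') \<le> S)"

definition close_maps :: "'a metric \<Rightarrow> 'b metric \<Rightarrow> ('a \<Rightarrow> 'b) \<Rightarrow> ('a \<Rightarrow> 'b) \<Rightarrow> bool" where
  "close_maps X Y f f' \<longleftrightarrow> bdd_above ((\<lambda>x. mdist Y (f x) (f' x)) ` mspace X)"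

definition coarse_equivalence :: "'a metric \<Rightarrow> 'b metric \<Rightarrow> ('a \<Rightarrow> 'b) \<Rightarrow> bool" where
  "coarse_equivalence X Y f \<longleftrightarrow>
     controlled X Y f \<and>
     (\<exists>h. controlled Y X h \<and> close_maps X X (h \<circ> f) id \<and> close_maps Y Y (f \<circ> h) id)"

text \<open>The next two notions are meant for metrics whose carrier is closed under addition;
  below the carrier is always the whole type.\<close>

definition coarse_homomorphism ::
  "'a::group_add metric \<Rightarrow> 'b::group_add metric \<Rightarrow> ('a \<Rightarrow> 'b) \<Rightarrow> bool" where
  "coarse_homomorphism X Y f \<longleftrightarrow>
     (\<exists>C\<ge>0. \<forall>a\<in>mspace X. \<forall>b\<in>mspace X. mdist Y (f (a + b)) (f a + f b) \<le> C)"

definition coarsely_isomorphic ::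
  "'a::group_add metric \<Rightarrow> 'b::group_add metric \<Rightarrow> bool" where
  "coarsely_isomorphic X Y \<longleftrightarrow> (\<exists>f. coarse_equivalence X Y f \<and> coarse_homomorphism X Y f)"

definition power_gens :: "int \<Rightarrow> int set" where
  "power_gens g = (\<Union>n::nat. {g ^ n, - (g ^ n)})"

definition word_length :: "int \<Rightarrow> int \<Rightarrow> nat" where
  "word_length g n =
     (LEAST k. \<exists>xs. length xs = k \<and> set xs \<subseteq> power_gens g \<and> sum_list xs = n)"

text \<open>The constructor \<^term>\<open>metric\<close> is only meaningful on actual metric spaces; see
  \<open>mspace_word_metric\<close> and \<open>mdist_word_metric\<close> below.\<close>

definition word_metric :: "int \<Rightarrow> int metric" where
  "word_metric g = metric (UNIV, \<lambda>n m. real (word_length g (n - m)))"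

lemma uminus_power_gens: "x \<in> power_gens g \<Longrightarrow> - x \<in> power_gens g"
  by (auto simp: power_gens_def)

lemma word_length_le:
  assumes "set xs \<subseteq> power_gens g"
  shows "word_length g (sum_list xs) \<le> length xs"
  unfolding word_length_def by (rule Least_le) (use assms in blast)

lemma ex_word: "\<exists>xs. set xs \<subseteq> power_gens g \<and> sum_list xs = n"
proof -
  have "1 \<in> power_gens g" "-1 \<in> power_gens g"
    by (auto simp: power_gens_def intro: exI[of _ "0::nat"])
  then show ?thesis
    by (intro exI[of _ "replicate (nat \<bar>n\<bar>) (sgn n)"])
       (auto simp: sum_list_replicate sgn_if)
qed

lemma word_length_witness:
  obtains xs where "length xs = word_length g n" "set xs \<subseteq> power_gens g" "sum_list xs = n"
proof -
  have "\<exists>xs. length xs = word_length g n \<and> set xs \<subseteq> power_gens g \<and> sum_list xs = n"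
    unfolding word_length_def by (rule LeastI_ex) (use ex_word[of g n] in blast)
  then show ?thesis using that by blast
qed

lemma word_length_eq_0_iff: "word_length g n = 0 \<longleftrightarrow> n = 0"
proof
  assume "word_length g n = 0"
  then show "n = 0" by (metis word_length_witness length_0_conv sum_list.Nil)
next
  assume "n = 0"
  then show "word_length g n = 0" using word_length_le[of "[]" g] by simp
qed

lemma word_length_uminus_le: "word_length g (- n) \<le> word_length g n"
proof -
  obtain xs where xs: "length xs = word_length g n" "set xs \<subseteq> power_gens g" "sum_list xs = n"
    by (rule word_length_witness)
  have "set (map uminus xs) \<subseteq> power_gens g"
    using xs(2) uminus_power_gens by auto
  moreover have "sum_list (map uminus xs) = - n"
    using xs(3) uminus_sum_list_map[of id xs] by (simp add: o_def id_def)
  ultimately show ?thesis using word_length_le[of "map uminus xs" g] xs(1) by simp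
qed

lemma word_length_uminus: "word_length g (- n) = word_length g n"
  using word_length_uminus_le[of g n] word_length_uminus_le[of g "- n"] by simp

lemma word_length_add_le: "word_length g (n + m) \<le> word_length g n + word_length g m"
proof -
  obtain xs where xs: "length xs = word_length g n" "set xs \<subseteq> power_gens g" "sum_list xs = n"
    by (rule word_length_witness)
  obtain ys where ys: "length ys = word_length g m" "set ys \<subseteq> power_gens g" "sum_list ys = m"
    by (rule word_length_witness)
  show ?thesis using word_length_le[of "xs @ ys" g] xs ys by simp
qed

lemma Metric_space_word_length: "Metric_space UNIV (\<lambda>n m. real (word_length g (n - m)))"
proof
  fix x y z :: int
  show "real (word_length g (x - y)) = real (word_length g (y - x))"
    using word_length_uminus[of g "x - y"] by simp
  show "real (word_length g (x - z)) \<le> real (word_length g (x - y)) + real (word_length g (y - z))"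
    using word_length_add_le[of g "x - y" "y - z"] by simp
qed (simp_all add: word_length_eq_0_iff)

lemma mspace_word_metric [simp]: "mspace (word_metric g) = UNIV"
  unfolding word_metric_def by (rule Metric_space.mspace_metric[OF Metric_space_word_length])

lemma mdist_word_metric: "mdist (word_metric g) n m = real (word_length g (n - m))"
  unfolding word_metric_def by (simp add: Metric_space.mdist_metric[OF Metric_space_word_length])

end

theory Submission
  imports Defs "HOL-Number_Theory.Residues"
begin

text \<open>Call multiplication by \<open>p\<close> coarsely injective on \<open>(\<int>, d\<^sub>g)\<close> if a bound on the length of \<open>p x\<close>
  implies a bound on the length of \<open>x\<close>. A coarse isomorphism almost commutes with multiplication
  by \<open>p\<close>, so it preserves this property. For \<open>g = 1\<close> it holds for every \<open>p > 0\<close>. For \<open>g \<ge> 2\<close> and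
  \<open>p\<close> prime it holds exactly if \<open>p\<close> divides \<open>g\<close>: division by \<open>g\<close> does not increase the length,
  whereas \<open>p\<close> not dividing \<open>g\<close> makes \<open>g ^ n - 1\<close> a multiple of \<open>p\<close> for suitable large \<open>n\<close>, and
  bounded length of the quotients \<open>(g ^ n - 1) / p\<close> would force their \<open>g\<close>-adic limit \<open>- 1 / p\<close> to
  be a finite sum of powers of \<open>g\<close>.\<close>

definition mult_coarsely_injective :: "int \<Rightarrow> int \<Rightarrow> bool" where
  "mult_coarsely_injective g p \<longleftrightarrow>
     (\<forall>K. \<exists>L. \<forall>x. word_length g (p * x) \<le> K \<longrightarrow> word_length g x \<le> L)"

section \<open>Elementary estimates for word length\<close>

lemma word_length_diff_triangle:
  "word_length g (x - z) \<le> word_length g (x - y) + word_length g (y - z)"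
  using word_length_add_le[of g "x - y" "y - z"] by simp

lemma word_length_le_add_diff: "word_length g x \<le> word_length g y + word_length g (x - y)"
  using word_length_add_le[of g y "x - y"] by simp

lemma word_length_diff_commute: "word_length g (x - y) = word_length g (y - x)"
  using word_length_uminus[of g "x - y"] by simp

lemma word_length_power_gens: "x \<in> power_gens g \<Longrightarrow> word_length g x \<le> 1"
  using word_length_le[of "[x]" g] by simp

lemma power_mem_power_gens: "g ^ n \<in> power_gens g"
  by (auto simp: power_gens_def)

lemma one_mem_power_gens: "1 \<in> power_gens g"
  using power_mem_power_gens[of g 0] by simp

lemma word_length_of_nat_mult_le: "word_length g (int k * x) \<le> k * word_length g x"
proof (induction k)
  case 0
  then show ?case by (simp add: word_length_eq_0_iff)
next
  case (Suc k)
  then show ?case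
    using word_length_add_le[of g x "int k * x"] by (simp add: algebra_simps)
qed

lemma word_length_le_abs: "word_length g x \<le> nat \<bar>x\<bar>"
proof -
  have *: "word_length g (int k) \<le> k" for k
    using word_length_of_nat_mult_le[of g k 1] word_length_power_gens[OF one_mem_power_gens[of g]]
      order_trans[OF _ mult_le_mono2[of "word_length g 1" 1 k]] by simp
  show ?thesis
    using *[of "nat \<bar>x\<bar>"] word_length_uminus[of g x] by (simp add: abs_if split: if_splits)
qed

section \<open>Division by the base and by its divisors\<close>

text \<open>Removing one factor \<open>g\<close> from each letter with positive exponent yields a
  word for \<open>y\<close>; the letters with exponent 0 are units and add up to \<open>r\<close>.
  Each letter is thus paid for only once.\<close>

lemma word_divide_base:
  assumes "set xs \<subseteq> power_gens g"
  shows "\<exists>y r. sum_list xs = g * y + r \<and> word_length g y + nat \<bar>r\<bar> \<le> length xs"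
  using assms
proof (induction xs)
  case Nil
  show ?case by (intro exI[of _ 0]) (simp add: word_length_eq_0_iff)
next
  case (Cons a xs)
  then obtain y r where yr: "sum_list xs = g * y + r"
      "word_length g y + nat \<bar>r\<bar> \<le> length xs" by auto
  obtain n where n: "a = g ^ n \<or> a = - (g ^ n)"
    using Cons.prems by (auto simp: power_gens_def)
  show ?case
  proof (cases n)
    case 0
    with n yr show ?thesis
      by (intro exI[of _ y] exI[of _ "r + a"]) auto
  next
    case (Suc m)
    define b where "b = (if a = g ^ n then g ^ m else - (g ^ m))"
    have "a = g * b" using n Suc by (auto simp: b_def)
    moreover have "b \<in> power_gens g"
      by (simp add: b_def power_mem_power_gens uminus_power_gens)
    ultimately show ?thesis
      using yr word_length_add_le[of g b y] word_length_power_gens[of b g]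
      by (intro exI[of _ "b + y"] exI[of _ r]) (auto simp: algebra_simps)
  qed
qed

text \<open>In \<open>g * x = g * y + r\<close> the remainder is \<open>g * (x - y)\<close>, and
  \<open>g\<close> has absolute value at least 1. The units counted for \<open>r\<close> therefore
  suffice to correct \<open>y\<close> to \<open>x\<close>.\<close>

lemma word_length_le_mult_base:
  assumes "g \<noteq> 0"
  shows "word_length g x \<le> word_length g (g * x)"
proof -
  obtain xs where xs: "length xs = word_length g (g * x)" "set xs \<subseteq> power_gens g"
    "sum_list xs = g * x" by (rule word_length_witness)
  from word_divide_base[OF xs(2)] xs obtain y r where
    yr: "g * x = g * y + r" "word_length g y + nat \<bar>r\<bar> \<le> word_length g (g * x)" by auto
  from yr(1) have r: "r = g * (x - y)" by (simp add: algebra_simps)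
  have "1 * \<bar>x - y\<bar> \<le> \<bar>g\<bar> * \<bar>x - y\<bar>"
    by (rule mult_right_mono) (use assms in auto)
  then have "nat \<bar>x - y\<bar> \<le> nat \<bar>r\<bar>" by (simp add: r abs_mult)
  then show ?thesis
    using yr(2) word_length_le_add_diff[of g x y] word_length_le_abs[of g "x - y"] by linarith
qed

text \<open>With \<open>g = p * q\<close>, the number \<open>g * x\<close> is a sum of
  \<open>q\<close> copies of \<open>p * x\<close>, and cancelling \<open>g\<close> does not increase
  the length.\<close>

lemma mult_coarsely_injective_dvd:
  assumes "g > 0" and "p > 0" and "p dvd g"
  shows "mult_coarsely_injective g p"
  unfolding mult_coarsely_injective_def
proof (intro allI exI impI)
  fix K x
  assume K: "word_length g (p * x) \<le> K"
  obtain q where q: "g = p * q" using assms by auto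
  with assms have "q > 0" by (simp add: zero_less_mult_iff)
  have "word_length g x \<le> word_length g (g * x)"
    using assms by (intro word_length_le_mult_base) simp
  also have "g * x = int (nat q) * (p * x)" using q \<open>q > 0\<close> by simp
  also have "word_length g \<dots> \<le> nat q * word_length g (p * x)"
    by (rule word_length_of_nat_mult_le)
  also have "\<dots> \<le> nat q * K" using K by simp
  finally show "word_length g x \<le> nat (g div p) * K" using q assms by simp
qed

lemma word_length_1: "word_length 1 x = nat \<bar>x\<bar>"
proof (rule antisym)
  obtain xs where xs: "length xs = word_length 1 x" "set xs \<subseteq> power_gens 1" "sum_list xs = x"
    by (rule word_length_witness)
  have "\<bar>sum_list xs\<bar> \<le> int (length xs)"
    using xs(2) by (induction xs) (auto simp: power_gens_def)
  then show "nat \<bar>x\<bar> \<le> word_length 1 x" using xs by simp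
qed (rule word_length_le_abs)

lemma mult_coarsely_injective_1:
  assumes "p > 0"
  shows "mult_coarsely_injective 1 p"
  unfolding mult_coarsely_injective_def
proof (intro allI exI impI)
  fix K x
  assume "word_length 1 (p * x) \<le> K"
  moreover have "1 * \<bar>x\<bar> \<le> p * \<bar>x\<bar>"
    by (rule mult_right_mono) (use assms in auto)
  ultimately show "word_length 1 x \<le> K" using assms by (simp add: word_length_1 abs_mult)
qed

section \<open>Primes that do not divide the base\<close>

lemma ex_power_not_dvd:
  fixes g a :: int
  assumes "g \<ge> 2" and "a \<noteq> 0"
  shows "\<exists>n. \<not> g ^ n dvd a"
proof -
  have "\<bar>a\<bar> < g ^ nat \<bar>a\<bar>"
    using assms(1) of_nat_less_two_power[of "nat \<bar>a\<bar>", where 'a = int] power_mono[of 2 g "nat \<bar>a\<bar>"]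
    by simp
  then show ?thesis using assms(2) zdvd_not_zless[of "\<bar>a\<bar>" "g ^ nat \<bar>a\<bar>"] by auto
qed

text \<open>A \<open>g\<close>-adic form, uniform over words of length \<open>k\<close>, of the fact
  that \<open>a + p * s = 0\<close> has no integer solution \<open>s\<close>. The induction moves a
  letter from the word into \<open>a\<close>, which remains indivisible by \<open>p\<close>; only
  finitely many letters have to be considered.\<close>

lemma words_bounded_away:
  assumes "g \<ge> 2" and "\<not> p dvd a"
  shows "\<exists>N. \<forall>xs. length xs = k \<longrightarrow> set xs \<subseteq> power_gens g \<longrightarrow>
           \<not> g ^ N dvd a + p * sum_list xs"
  using assms(2)
proof (induction k arbitrary: a)
  case (0 a)
  have "a \<noteq> 0" using 0 by auto
  then show ?case using ex_power_not_dvd[OF assms(1)] by auto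
next
  case (Suc k a)
  have "a \<noteq> 0" using Suc.prems by auto
  then obtain M where M: "\<not> g ^ M dvd a" using ex_power_not_dvd[OF assms(1)] by blast
  \<comment> \<open>Every generator that \<open>g ^ M\<close> does not divide lies in
    \<open>E\<close>.\<close>
  define E where "E = (\<Union>j<M. {g ^ j, - (g ^ j)})"
  have "finite E" by (simp add: E_def)
  have "\<not> p dvd a + p * e" for e
    using Suc.prems dvd_add_left_iff[of p "p * e" a] by simp
  then have "\<forall>e. \<exists>N. \<forall>xs. length xs = k \<longrightarrow> set xs \<subseteq> power_gens g \<longrightarrow>
      \<not> g ^ N dvd (a + p * e) + p * sum_list xs"
    using Suc.IH by blast
  then obtain N where N: "length xs = k \<Longrightarrow> set xs \<subseteq> power_gens g \<Longrightarrow>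
      \<not> g ^ N e dvd (a + p * e) + p * sum_list xs" for e xs
    by metis
  \<comment> \<open>Dominates \<open>M\<close> and, \<open>E\<close> being finite, every
    \<open>N e\<close> with \<open>e\<close> in \<open>E\<close>.\<close>
  define N' where "N' = M + (\<Sum>e\<in>E. N e)"
  show ?case
  proof (intro exI[of _ N'] allI impI notI)
    fix xs
    assume xs: "length xs = Suc k" "set xs \<subseteq> power_gens g" and dvd: "g ^ N' dvd a + p * sum_list xs"
    show False
    \<comment> \<open>Either the word vanishes modulo \<open>g ^ M\<close>, and the choice of
      \<open>M\<close> for \<open>a\<close> decides, or some letter \<open>e\<close> lies in
      \<open>E\<close>, and the bound for \<open>a + p * e\<close> applies to the remaining
      \<open>k\<close> letters.\<close>
    proof (cases "\<forall>x\<in>set xs. g ^ M dvd x")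
      case True
      then have "g ^ M dvd sum_list xs" by (induction xs) auto
      moreover have "g ^ M dvd a + p * sum_list xs"
        using dvd by (rule power_le_dvd) (simp add: N'_def)
      ultimately show False using M by (simp add: dvd_add_left_iff)
    next
      case False
      then obtain e where e: "e \<in> set xs" "\<not> g ^ M dvd e" by auto
      then obtain n where n: "e = g ^ n \<or> e = - (g ^ n)" using xs by (auto simp: power_gens_def)
      have "n < M" using e n le_imp_power_dvd[of M n g] by (meson dvd_minus_iff not_le)
      then have "e \<in> E" using n by (auto simp: E_def)
      then have "N e \<le> N'"
        using member_le_sum[of e E N] \<open>finite E\<close> by (simp add: N'_def)
      then have "g ^ N e dvd a + p * sum_list xs" by (rule power_le_dvd[OF dvd])
      moreover have "sum_list xs = e + sum_list (remove1 e xs)"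
        using e by (simp add: sum_list_map_remove1[of e xs id, simplified])
      ultimately have "g ^ N e dvd (a + p * e) + p * sum_list (remove1 e xs)"
        by (simp add: algebra_simps)
      moreover have "length (remove1 e xs) = k" "set (remove1 e xs) \<subseteq> power_gens g"
        using e xs set_remove1_subset[of e xs] by (auto simp: length_remove1)
      ultimately show False using N by blast
    qed
  qed
qed

lemma ex_power_cong_1:
  assumes "prime (p :: int)" and "\<not> p dvd g"
  shows "\<exists>n\<ge>N. p dvd g ^ n - 1"
proof -
  have p: "p > 1" using assms prime_gt_1_int by blast
  then interpret residues p "residue_ring p" by unfold_locales auto
  have "coprime g p" using assms prime_imp_coprime[of p g] coprime_commute by blast
  then have "[g ^ totient (nat p) = 1] (mod p)"
    by (rule euler_theorem)
  \<comment> \<open>As the totient is positive, the \<open>N\<close>-th power pushes the exponent up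
    to at least \<open>N\<close>.\<close>
  then have "[(g ^ totient (nat p)) ^ N = 1 ^ N] (mod p)" by (rule cong_pow)
  then have "p dvd g ^ (totient (nat p) * N) - 1"
    by (simp add: power_mult cong_iff_dvd_diff)
  moreover have "totient (nat p) * N \<ge> N" using p
    by (cases "totient (nat p)") auto
  ultimately show ?thesis by blast
qed

lemma not_mult_coarsely_injective:
  assumes "g \<ge> 2" and "prime p" and "\<not> p dvd g"
  shows "\<not> mult_coarsely_injective g p"
proof
  assume "mult_coarsely_injective g p"
  \<comment> \<open>The bound 2 suits \<open>g ^ n - 1\<close>, a sum of two generators for every
    \<open>n\<close>.\<close>
  then obtain L where L: "word_length g (p * x) \<le> 2 \<Longrightarrow> word_length g x \<le> L" for x
    unfolding mult_coarsely_injective_def by blast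
  have "\<not> p dvd 1" using assms by auto
  then have "\<forall>k. \<exists>N. \<forall>xs. length xs = k \<longrightarrow> set xs \<subseteq> power_gens g \<longrightarrow>
      \<not> g ^ N dvd 1 + p * sum_list xs"
    using words_bounded_away[OF assms(1)] by blast
  then obtain N where N: "length xs = k \<Longrightarrow> set xs \<subseteq> power_gens g \<Longrightarrow>
      \<not> g ^ N k dvd 1 + p * sum_list xs" for k xs
    by metis
  \<comment> \<open>The length of the quotient \<open>x\<close> will be known only to be at most
    \<open>L\<close>, so \<open>n\<close> has to dominate \<open>N k\<close> for all these lengths
    \<open>k\<close>.\<close>
  obtain n where n: "n \<ge> (\<Sum>k\<le>L. N k)" "p dvd g ^ n - 1"
    using ex_power_cong_1[OF assms(2,3)] by blast
  then obtain x where x: "p * x = g ^ n - 1" by (metis dvdE)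
  have "word_length g (p * x) \<le> 2"
    using word_length_add_le[of g "g ^ n" "- 1"] word_length_uminus[of g 1]
      word_length_power_gens[OF power_mem_power_gens[of g n]]
      word_length_power_gens[OF one_mem_power_gens[of g]]
    by (simp add: x)
  then have "word_length g x \<le> L" by (rule L)
  then have "N (word_length g x) \<le> n"
    using member_le_sum[of "word_length g x" "{..L}" N] n(1) by simp
  then have "g ^ N (word_length g x) dvd 1 + p * x" by (simp add: x le_imp_power_dvd)
  then show False by (metis N word_length_witness)
qed

section \<open>Coarse isomorphisms between word metrics\<close>

lemma controlled_word_metricD:
  assumes "controlled (word_metric g) (word_metric g') f" and "R \<ge> 0"
  shows "\<exists>S\<ge>0. \<forall>x y. real (word_length g (x - y)) \<le> R \<longrightarrow> real (word_length g' (f x - f y)) \<le> S"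
  using assms unfolding controlled_def mdist_word_metric by simp

lemma close_maps_word_metricD:
  assumes "close_maps (word_metric g) (word_metric g) f id"
  shows "\<exists>S. \<forall>x. real (word_length g (f x - x)) \<le> S"
  using assms unfolding close_maps_def bdd_above_def mdist_word_metric by auto

text \<open>Rounding the real bounds up, and collecting them in functions \<open>\<rho>\<close>,
  \<open>\<sigma>\<close> and one constant \<open>C\<close>, allows later estimates to stay within
  the natural numbers.\<close>

lemma coarsely_isomorphic_word_metricD:
  assumes "coarsely_isomorphic (word_metric g) (word_metric g')"
  shows "\<exists>f h \<rho> \<sigma> C.
    (\<forall>x y R. word_length g (x - y) \<le> R \<longrightarrow> word_length g' (f x - f y) \<le> \<rho> R) \<and>
    (\<forall>x y R. word_length g' (x - y) \<le> R \<longrightarrow> word_length g (h x - h y) \<le> \<sigma> R) \<and>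
    (\<forall>x. word_length g (h (f x) - x) \<le> C) \<and>
    (\<forall>x y. word_length g' (f (x + y) - (f x + f y)) \<le> C)"
proof -
  have control: "\<exists>\<rho>. \<forall>x y R. word_length a (x - y) \<le> R \<longrightarrow> word_length b (k x - k y) \<le> \<rho> R"
    if k: "controlled (word_metric a) (word_metric b) k" for a b k
  proof -
    have "\<exists>S. \<forall>x y. word_length a (x - y) \<le> R \<longrightarrow> word_length b (k x - k y) \<le> S" for R
    proof -
      obtain S where "\<And>x y. real (word_length a (x - y)) \<le> real R \<Longrightarrow>
          real (word_length b (k x - k y)) \<le> S"
        using controlled_word_metricD[OF k, of "real R"] by auto
      then show ?thesis
        by (intro exI[of _ "nat \<lceil>S\<rceil>"]) (meson of_nat_le_iff order_trans real_nat_ceiling_ge)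
    qed
    then show ?thesis by metis
  qed
  have closeness: "\<exists>C. \<forall>x. word_length a (k x - x) \<le> C"
    if k: "close_maps (word_metric a) (word_metric a) k id" for a k
  proof -
    obtain S where "\<And>x. real (word_length a (k x - x)) \<le> S"
      using close_maps_word_metricD[OF k] by auto
    then show ?thesis
      by (intro exI[of _ "nat \<lceil>S\<rceil>"]) (meson of_nat_le_iff order_trans real_nat_ceiling_ge)
  qed
  obtain f h where f: "controlled (word_metric g) (word_metric g') f"
    and h: "controlled (word_metric g') (word_metric g) h"
    and hf: "close_maps (word_metric g) (word_metric g) (h \<circ> f) id"
    and hom: "coarse_homomorphism (word_metric g) (word_metric g') f"
    using assms unfolding coarsely_isomorphic_def coarse_equivalence_def by blast
  obtain S where S: "\<And>x y. real (word_length g' (f (x + y) - (f x + f y))) \<le> S"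
    using hom unfolding coarse_homomorphism_def mdist_word_metric by auto
  have C3: "word_length g' (f (x + y) - (f x + f y)) \<le> nat \<lceil>S\<rceil>" for x y
    using S[of x y] by (meson of_nat_le_iff order_trans real_nat_ceiling_ge)
  obtain \<rho> \<sigma> where \<rho>: "\<And>x y R. word_length g (x - y) \<le> R \<Longrightarrow> word_length g' (f x - f y) \<le> \<rho> R"
    and \<sigma>: "\<And>x y R. word_length g' (x - y) \<le> R \<Longrightarrow> word_length g (h x - h y) \<le> \<sigma> R"
    using control[OF f] control[OF h] by blast
  obtain C1 where C1: "\<And>x. word_length g (h (f x) - x) \<le> C1"
    using closeness[OF hf] by auto
  show ?thesis
    by (intro exI[of _ f] exI[of _ h] exI[of _ \<rho>] exI[of _ \<sigma>] exI[of _ "C1 + nat \<lceil>S\<rceil>"])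
      (use \<rho> \<sigma> C1 C3 in \<open>auto intro: trans_le_add1 trans_le_add2\<close>)
qed

text \<open>The point \<open>f (h a + h b)\<close> is close to \<open>a + b\<close>. Applying
  \<open>h\<close> to both and using that \<open>h \<circ> f\<close> is close to the identity
  compares \<open>h a + h b\<close> with \<open>h (a + b)\<close>.\<close>

lemma coarse_homomorphism_coarse_inverse:
  assumes h: "controlled (word_metric g') (word_metric g) h"
    and hf: "close_maps (word_metric g) (word_metric g) (h \<circ> f) id"
    and fh: "close_maps (word_metric g') (word_metric g') (f \<circ> h) id"
    and hom: "coarse_homomorphism (word_metric g) (word_metric g') f"
  shows "coarse_homomorphism (word_metric g') (word_metric g) h"
proof -
  obtain S1 where S1: "\<And>x. real (word_length g (h (f x) - x)) \<le> S1"
    using close_maps_word_metricD[OF hf] by auto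
  obtain S2 where S2: "\<And>x. real (word_length g' (f (h x) - x)) \<le> S2"
    using close_maps_word_metricD[OF fh] by auto
  obtain C where C: "\<And>x y. real (word_length g' (f (x + y) - (f x + f y))) \<le> C"
    using hom unfolding coarse_homomorphism_def mdist_word_metric by auto
  have "S1 \<ge> 0" "S2 \<ge> 0" "C \<ge> 0" using S1 S2 C of_nat_0_le_iff order_trans by blast+
  \<comment> \<open>\<open>C\<close> is the additivity error of \<open>f\<close> at
    \<open>h a\<close>, \<open>h b\<close>; the two \<open>S2\<close> account for
    \<open>f (h a)\<close> against \<open>a\<close> and \<open>f (h b)\<close> against
    \<open>b\<close>.\<close>
  then obtain S where S: "S \<ge> 0" "\<And>x y. real (word_length g' (x - y)) \<le> C + 2 * S2 \<Longrightarrow>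
      real (word_length g (h x - h y)) \<le> S"
    using controlled_word_metricD[OF h, of "C + 2 * S2"] by auto
  have "real (word_length g (h (a + b) - (h a + h b))) \<le> S + S1" for a b
  proof -
    let ?x = "h a + h b"
    have "word_length g' (f ?x - (a + b)) \<le> word_length g' (f ?x - (f (h a) + f (h b)))
        + word_length g' ((f (h a) - a) + (f (h b) - b))"
      using word_length_diff_triangle[of g' "f ?x" "a + b" "f (h a) + f (h b)"]
      by (simp add: algebra_simps)
    also have "\<dots> \<le> word_length g' (f ?x - (f (h a) + f (h b)))
        + (word_length g' (f (h a) - a) + word_length g' (f (h b) - b))"
      by (intro add_left_mono word_length_add_le)
    finally have "real (word_length g' (f ?x - (a + b))) \<le> C + 2 * S2"
      using C[of "h a" "h b"] S2[of a] S2[of b] by linarith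
    then have "real (word_length g (h (f ?x) - h (a + b))) \<le> S" by (rule S)
    moreover have "word_length g (h (a + b) - ?x)
        \<le> word_length g (h (f ?x) - h (a + b)) + word_length g (h (f ?x) - ?x)"
      by (metis word_length_diff_triangle word_length_diff_commute)
    ultimately show ?thesis using S1[of ?x] by linarith
  qed
  then show ?thesis
    using S(1) \<open>S1 \<ge> 0\<close> unfolding coarse_homomorphism_def mdist_word_metric
    by (intro exI[of _ "S + S1"]) auto
qed

lemma coarsely_isomorphic_word_metric_sym:
  assumes "coarsely_isomorphic (word_metric g) (word_metric g')"
  shows "coarsely_isomorphic (word_metric g') (word_metric g)"
  using assms coarse_homomorphism_coarse_inverse
  unfolding coarsely_isomorphic_def coarse_equivalence_def by blast

text \<open>A length bound passes along \<open>p * x\<close>, \<open>f (p * x)\<close>,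
  \<open>p * f x\<close>, \<open>f x\<close>, \<open>h (f x)\<close>, \<open>x\<close>; the
  hypothesis on \<open>g'\<close> gives the step from \<open>p * f x\<close> to
  \<open>f x\<close>.\<close>

lemma mult_coarsely_injective_coarsely_isomorphic:
  assumes iso: "coarsely_isomorphic (word_metric g) (word_metric g')"
    and "p > 0" and inj: "mult_coarsely_injective g' p"
  shows "mult_coarsely_injective g p"
  unfolding mult_coarsely_injective_def
proof
  fix K
  obtain f h \<rho> \<sigma> C where
    f: "\<And>x y R. word_length g (x - y) \<le> R \<Longrightarrow> word_length g' (f x - f y) \<le> \<rho> R"
    and h: "\<And>x y R. word_length g' (x - y) \<le> R \<Longrightarrow> word_length g (h x - h y) \<le> \<sigma> R"
    and hf: "\<And>x. word_length g (h (f x) - x) \<le> C"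
    and hom: "\<And>x y. word_length g' (f (x + y) - (f x + f y)) \<le> C"
    using coarsely_isomorphic_word_metricD[OF iso] by blast
  have f0: "word_length g' (f 0) \<le> C"
    using hom[of 0 0] word_length_uminus[of g' "f 0"] by simp
  \<comment> \<open>One \<open>C\<close> pays for \<open>f 0\<close>, and each added copy of
    \<open>x\<close> costs another.\<close>
  have mult: "word_length g' (int k * f x - f (int k * x)) \<le> Suc k * C" for k x
  proof (induction k)
    case 0
    then show ?case using f0 by (simp add: word_length_uminus)
  next
    case (Suc k)
    have "word_length g' ((int k * f x - f (int k * x)) + (f (int k * x) + f x - f (int k * x + x)))
        \<le> Suc k * C + C"
      by (rule order_trans[OF word_length_add_le add_mono])
         (use Suc hom word_length_diff_commute in metis)+
    then show ?case by (simp add: algebra_simps)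
  qed
  \<comment> \<open>The summands bound, in turn, the length of \<open>f 0\<close>, the distance from
    \<open>f 0\<close> to \<open>f (p * x)\<close>, and that from \<open>f (p * x)\<close> to
    \<open>p * f x\<close>.\<close>
  define K' where "K' = C + \<rho> K + Suc (nat p) * C"
  obtain L where L: "word_length g' (p * y) \<le> K' \<Longrightarrow> word_length g' y \<le> L" for y
    using inj unfolding mult_coarsely_injective_def by blast
  show "\<exists>L. \<forall>x. word_length g (p * x) \<le> K \<longrightarrow> word_length g x \<le> L"
  proof (intro exI allI impI)
    fix x
    assume "word_length g (p * x) \<le> K"
    then have "word_length g' (f (p * x) - f 0) \<le> \<rho> K" using f[of "p * x" 0 K] by simp
    then have "word_length g' (p * f x) \<le> K'"
      using mult[of "nat p" x] f0 \<open>p > 0\<close>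
        word_length_le_add_diff[of g' "f (p * x)" "f 0"]
        word_length_le_add_diff[of g' "p * f x" "f (p * x)"]
      by (simp add: K'_def)
    then have "word_length g' (f x - 0) \<le> L" using L by simp
    then have "word_length g (h (f x) - h 0) \<le> \<sigma> L" by (rule h)
    then show "word_length g x \<le> word_length g (h 0) + \<sigma> L + C"
      using hf[of x] word_length_diff_commute[of g x "h (f x)"]
        word_length_le_add_diff[of g "h (f x)" "h 0"]
        word_length_le_add_diff[of g x "h (f x)"]
      by linarith
  qed
qed

section \<open>Recovering the prime divisors of the base\<close>

lemma mult_coarsely_injective_iff:
  assumes "g \<ge> 1" and "prime p"
  shows "mult_coarsely_injective g p \<longleftrightarrow> g = 1 \<or> p dvd g"
  using assms mult_coarsely_injective_1[of p] mult_coarsely_injective_dvd[of g p]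
    not_mult_coarsely_injective[of g p] prime_gt_0_int[of p]
  by fastforce

text \<open>Base 1 needs separate treatment: it has no prime divisors, yet multiplication by every
  prime is coarsely injective there. A prime larger than \<open>g\<close> tells the two bases
  apart.\<close>

lemma not_coarsely_isomorphic_word_metric_1:
  assumes "g \<ge> 2"
  shows "\<not> coarsely_isomorphic (word_metric g) (word_metric 1)"
proof
  assume iso: "coarsely_isomorphic (word_metric g) (word_metric 1)"
  obtain p where p: "prime p" "p > nat g" using bigger_prime by blast
  have "\<not> int p dvd g" using p assms zdvd_not_zless[of g "int p"] by auto
  then have "\<not> mult_coarsely_injective g (int p)"
    using assms p by (intro not_mult_coarsely_injective) auto
  then show False
    using mult_coarsely_injective_coarsely_isomorphic[OF iso, of "int p"]
      mult_coarsely_injective_1[of "int p"] p by (auto simp: prime_gt_0_nat)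
qed

theorem theoremA:
  fixes g1 g2 :: int
  assumes "g1 \<ge> 1" and "g2 \<ge> 1"
    and "{p. prime p \<and> p dvd g1} \<noteq> {p. prime p \<and> p dvd g2}"
  shows "\<not> coarsely_isomorphic (word_metric g1) (word_metric g2)"
proof
  assume iso: "coarsely_isomorphic (word_metric g1) (word_metric g2)"
  note iso' = coarsely_isomorphic_word_metric_sym[OF iso]
  \<comment> \<open>If both bases were 1, their prime divisors would agree. So one base is at least
    2, and the isomorphism then forbids the other to be 1.\<close>
  have "g1 \<noteq> 1 \<or> g2 \<noteq> 1" using assms(3) by auto
  then have "g1 \<noteq> 1" "g2 \<noteq> 1"
    using not_coarsely_isomorphic_word_metric_1[of g1] not_coarsely_isomorphic_word_metric_1[of g2]
      iso iso' assms(1,2) by fastforce+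
  then have "p dvd g1 \<longleftrightarrow> p dvd g2" if "prime p" for p
    using that assms(1,2) mult_coarsely_injective_iff[of _ p] prime_gt_0_int[of p]
      mult_coarsely_injective_coarsely_isomorphic[OF iso, of p]
      mult_coarsely_injective_coarsely_isomorphic[OF iso', of p]
    by blast
  then show False using assms(3) by blast
qed

end
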